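(* Let $M$ be a nontrivial atomic Puiseux monoid, and let $\mathcal{A}(M)$ denote its set of atoms. Then the following hold. (1) $M$ is an HF-monoid if and only if $M$ is factorial. (2) $M$ is an OHF-monoid if and only if $|\mathcal{A}(M)| \le 2$.
   Context: A monoid is a commutative and cancellative semigroup with an identity element; $U(M)$ denotes the set of invertible elements of a monoid $M$. A Puiseux monoid is an additive submonoid of $(\mathbb{Q}_{\ge 0},+)$; it is nontrivial if it is not $\{0\}$. The notions below are stated for a multiplicatively written monoid $M$ and are applied to Puiseux monoids in additive notation. For $y,z \in M$, $y \mid_M z$ means $z = xy$ for some $x \in M$; $y$ and $z$ are associates if $y \mid_M z$ and $z \mid_M y$. An element $p \in M\setminus U(M)$ is prime if $p \mid_M xy$ implies $p \mid_M x$ or $p \mid_M y$, for all $x,y\in M$. $M$ is factorial if every element of $M \setminus U(M)$ is a product of primes. An element $a \in M\setminus U(M)$ is an atom if $a = xy$ with $x,y \in M$ implies $x \in U(M)$ or $y \in U(M)$. $M$ is atomic if every element of $M\setminus U(M)$ is a product of atoms. A factorization of $x \in M \setminus U(M)$ is a formal product $z = a_1\cdots a_m$ of atoms ($m \ge 1$) whose value in $M$ is $x$; its length is $|z| = m$. Two factorizations $a_1\cdots a_m$ and $b_1\cdots b_n$ of $x$ are considered equal if $m = n$ and there is a permutation $\sigma$ of $\{1,\dots,m\}$ such that $b_i$ and $a_{\sigma(i)}$ are associates for every $i$. $\mathsf{Z}(x)$ denotes the set of factorizations of $x$. An atomic monoid $M$ is an HF-monoid (half-factorial) if for all $x \in M\setminus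 U(M)$ and $z,z' \in \mathsf{Z}(x)$ one has $|z| = |z'|$. An atomic monoid $M$ is an OHF-monoid (other-half-factorial) if for all $x \in M\setminus U(M)$ and $z,z'\in \mathsf{Z}(x)$, the equality $|z| = |z'|$ implies $z = z'$. *)

theory Defs
  imports Complex_Main "HOL-Algebra.Divisibility"
begin

section \<open>Factorizations in commutative cancellative monoids\<close>

text \<open>
  The definitions below are meant for structures satisfying \<^locale>\<open>comm_monoid_cancel\<close>.
  Divisibility, associates and primes are those of the library.
\<close>

definition atoms :: "('a, 'b) monoid_scheme \<Rightarrow> 'a set" where
  "atoms G = {a \<in> carrier G - Units G.
     \<forall>x\<in>carrier G. \<forall>y\<in>carrier G. a = x \<otimes>\<^bsub>G\<^esub> y \<longrightarrow> x \<in> Units G \<or> y \<in> Units G}"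

definition list_product :: "('a, 'b) monoid_scheme \<Rightarrow> 'a list \<Rightarrow> 'a" where
  "list_product G xs = foldr (\<otimes>\<^bsub>G\<^esub>) xs \<one>\<^bsub>G\<^esub>"

definition factorial :: "('a, 'b) monoid_scheme \<Rightarrow> bool" where
  "factorial G \<longleftrightarrow> (\<forall>x \<in> carrier G - Units G.
     \<exists>ps. set ps \<subseteq> {p \<in> carrier G. prime G p} \<and> list_product G ps = x)"

text \<open>
  A formal product of atoms is represented by a list, and two lists stand for the same
  factorization iff they are \<^const>\<open>essentially_equal\<close>, that is, equal up to
  order and associates.  No condition that the list is nonempty is needed, since the value of the
  empty list is the identity, which is a unit.
\<close>

definition factorizations :: "('a, 'b) monoid_scheme \<Rightarrow> 'a \<Rightarrow> 'a list set" where
  "factorizations G x = {z. set z \<subseteq> atoms G \<and> list_product G z = x}"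

definition atomic :: "('a, 'b) monoid_scheme \<Rightarrow> bool" where
  "atomic G \<longleftrightarrow> (\<forall>x \<in> carrier G - Units G. factorizations G x \<noteq> {})"

definition HF_monoid :: "('a, 'b) monoid_scheme \<Rightarrow> bool" where
  "HF_monoid G \<longleftrightarrow> atomic G \<and>
     (\<forall>x \<in> carrier G - Units G. \<forall>z \<in> factorizations G x. \<forall>z' \<in> factorizations G x.
        length z = length z')"

definition OHF_monoid :: "('a, 'b) monoid_scheme \<Rightarrow> bool" where
  "OHF_monoid G \<longleftrightarrow> atomic G \<and>
     (\<forall>x \<in> carrier G - Units G. \<forall>z \<in> factorizations G x. \<forall>z' \<in> factorizations G x.
        length z = length z' \<longrightarrow> essentially_equal G z z')"

lemma (in comm_monoid_cancel) atoms_eq_irreducible: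
  "atoms G = {a \<in> carrier G. irreducible G a}"
proof (intro equalityI subsetI)
  fix a assume a: "a \<in> atoms G"
  then have ac: "a \<in> carrier G" "a \<notin> Units G" unfolding atoms_def by blast+
  have "b \<in> Units G" if b: "b \<in> carrier G" "properfactor G b a" for b
  proof -
    from b obtain c where c: "c \<in> carrier G" "a = b \<otimes> c"
      unfolding properfactor_def factor_def by blast
    have "c \<notin> Units G"
    proof
      assume cu: "c \<in> Units G"
      have "a \<otimes> inv c = b \<otimes> (c \<otimes> inv c)"
        using m_assoc[of b c "inv c"] b(1) c cu by simp
      also have "\<dots> = b" using b(1) cu by simp
      finally have "b = a \<otimes> inv c" ..
      then have "a divides b" using cu Units_inv_closed unfolding factor_def by blast
      with b show False by (simp add: properfactor_def)
    qed
    with a b(1) c show ?thesis unfolding atoms_def by blast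
  qed
  with ac show "a \<in> {a \<in> carrier G. irreducible G a}" by (simp add: irreducible_def)
next
  fix a assume "a \<in> {a \<in> carrier G. irreducible G a}"
  then have ac: "a \<in> carrier G" "a \<notin> Units G"
    and irr: "\<And>b. b \<in> carrier G \<Longrightarrow> properfactor G b a \<Longrightarrow> b \<in> Units G"
    unfolding irreducible_def by blast+
  have "x \<in> Units G \<or> y \<in> Units G"
    if xy: "x \<in> carrier G" "y \<in> carrier G" "a = x \<otimes> y" for x y
  proof (cases "a divides x")
    case True
    then obtain d where d: "d \<in> carrier G" "x = a \<otimes> d" unfolding factor_def by blast
    have "x \<otimes> (y \<otimes> d) = a \<otimes> d"
      using m_assoc[OF xy(1,2) d(1)] unfolding xy(3) by (rule sym)
    also have "\<dots> = x \<otimes> \<one>" by (rule trans[OF d(2)[symmetric] r_one[OF xy(1), symmetric]])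
    finally have yd: "y \<otimes> d = \<one>"
      by (rule l_cancel) (use xy(1,2) d(1) in simp_all)
    then have "d \<otimes> y = \<one>" using m_comm[OF d(1) xy(2)] by simp
    with yd have "y \<in> Units G" using xy(2) d(1) unfolding Units_def by blast
    then show ?thesis ..
  next
    case False
    moreover have "x divides a" using xy unfolding factor_def by blast
    ultimately show ?thesis using irr[OF xy(1)] unfolding properfactor_def by blast
  qed
  with ac show "a \<in> atoms G" unfolding atoms_def by blast
qed


section \<open>Puiseux monoids\<close>

definition puiseux_monoid :: "rat set \<Rightarrow> bool" where
  "puiseux_monoid M \<longleftrightarrow> M \<subseteq> {0..} \<and> 0 \<in> M \<and> (\<forall>x\<in>M. \<forall>y\<in>M. x + y \<in> M)"

definition additive_monoid :: "rat set \<Rightarrow> rat monoid" where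
  "additive_monoid M = \<lparr>carrier = M, mult = (+), one = 0\<rparr>"

lemma comm_monoid_cancel_additive_monoid:
  assumes "puiseux_monoid M"
  shows "comm_monoid_cancel (additive_monoid M)"
  using assms unfolding puiseux_monoid_def additive_monoid_def
  by (intro comm_monoid_cancelI comm_monoidI) (auto simp: add_ac)

end

theory Submission
  imports Defs
begin

text \<open>
  The number of atoms governs both equivalences, because any two positive rationals \<open>a\<close> and \<open>b\<close>
  are commensurable: \<open>m a = n b\<close> for some positive integers \<open>m\<close> and \<open>n\<close>.  This supplies
  relations between any two atoms, and the relations between at most two atoms are easily
  understood.

  For two distinct atoms, \<open>m a = n b\<close> is a relation with \<open>m \<noteq> n\<close>, which contradicts
  half-factoriality; it also prevents \<open>a\<close> from being prime, since \<open>a\<close> divides \<open>n b\<close> but not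
  \<open>b\<close>.  With a single atom \<open>a\<close>, on the other hand, every element is a multiple of \<open>a\<close>, so that
  lengths are unique and \<open>a\<close> is prime.  Hence an atomic Puiseux monoid is half-factorial iff it
  has at most one atom iff it is factorial (\<open>HF_monoid_iff_unique_atom\<close> and
  \<open>factorial_iff_unique_atom\<close>).

  For three atoms \<open>a < b < c\<close>, commensurability of the gaps \<open>b - a\<close> and \<open>c - b\<close>, say
  \<open>i (b - a) = k (c - b)\<close>, gives the relation \<open>i a + k c = (i + k) b\<close>, whose two sides are
  different factorizations of the same length.  For two atoms \<open>a \<noteq> b\<close>, the length
  and the value of a factorization form a nonsingular linear system for the two
  multiplicities, so together they determine the factorization (\<open>OHF_monoid_iff_atoms_le_2\<close>).
\<close>

section \<open>Commensurability and sums over two values\<close>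

lemma rat_commensurable:
  fixes a b :: rat
  assumes "a > 0" "b > 0"
  obtains m n :: nat where "m > 0" "n > 0" "of_nat m * a = of_nat n * b"
proof -
  obtain p q where pq: "a / b = of_int p / of_int q" "q > 0"
    by (metis quotient_of_div quotient_of_denom_pos surj_pair)
  have "a / b > 0" using assms by simp
  with pq have p: "p > 0" by (simp add: zero_less_divide_iff)
  have "of_int q * a = of_int p * b" using pq assms by (simp add: field_simps)
  then have "of_nat (nat q) * a = of_nat (nat p) * b" using p pq(2) by simp
  with p pq(2) show thesis using that[of "nat q" "nat p"] by simp
qed

lemma sum_list_two_values:
  fixes a b :: rat
  assumes "set z \<subseteq> {a, b}"
  shows "sum_list z = of_nat (length z) * a + of_nat (count (mset z) b) * (b - a)"
  using assms by (induction z) (auto simp: algebra_simps)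

lemma mset_two_values:
  assumes "set z \<subseteq> {a, b}" "a \<noteq> b"
  shows "mset z = replicate_mset (length z - count (mset z) b) a + replicate_mset (count (mset z) b) b"
proof -
  have "count (mset z) a + count (mset z) b = length z"
    using assms by (induction z) auto
  moreover have "count (mset z) x = 0" if "x \<notin> {a, b}" for x
    using assms(1) that by (auto simp: count_eq_zero_iff)
  ultimately show ?thesis using assms(2) by (auto intro!: multiset_eqI)
qed

section \<open>Divisibility and factorizations in a Puiseux monoid\<close>

context
  fixes M :: "rat set"
  assumes pm: "puiseux_monoid M"
begin

abbreviation "P \<equiv> additive_monoid M"

lemma carrier_P [simp]: "carrier P = M"
  and mult_P [simp]: "x \<otimes>\<^bsub>P\<^esub> y = x + y"
  and one_P [simp]: "\<one>\<^bsub>P\<^esub> = 0"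
  by (simp_all add: additive_monoid_def)

lemma zero_in: "0 \<in> M" and add_in: "x \<in> M \<Longrightarrow> y \<in> M \<Longrightarrow> x + y \<in> M"
  and nonneg: "x \<in> M \<Longrightarrow> 0 \<le> x"
  using pm by (auto simp: puiseux_monoid_def)

lemma Units_P [simp]: "Units P = {0}"
proof -
  have "y + x = 0 \<longleftrightarrow> y = 0 \<and> x = 0" if "x \<in> M" "y \<in> M" for x y
    using nonneg that by (simp add: add_nonneg_eq_0_iff)
  then show ?thesis using zero_in by (auto simp: Units_def)
qed

lemma list_product_P [simp]: "list_product P z = sum_list z"
  by (induction z) (simp_all add: list_product_def)

lemma divides_P: "x divides\<^bsub>P\<^esub> y \<longleftrightarrow> y - x \<in> M"
  by (force simp: factor_def)

lemma associated_P:
  "x \<sim>\<^bsub>P\<^esub> y \<longleftrightarrow> x = y"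
  using nonneg[of "x - y"] nonneg[of "y - x"] zero_in
  by (auto simp: associated_def divides_P)

text \<open>
  Since \<open>0\<close> is the only unit, associates are equal, so that factorizations are just multisets of
  atoms.
\<close>

lemma essentially_equal_P: "essentially_equal P z z' \<longleftrightarrow> mset z = mset z'"
proof -
  have "(\<sim>\<^bsub>P\<^esub>) = (=)" by (intro ext) (rule associated_P)
  then show ?thesis by (auto simp: essentially_equal_def list.rel_eq)
qed

lemma atoms_P:
  "a \<in> atoms P \<longleftrightarrow> a \<in> M \<and> a \<noteq> 0 \<and> (\<forall>x\<in>M. \<forall>y\<in>M. a = x + y \<longrightarrow> x = 0 \<or> y = 0)"
  by (auto simp: atoms_def)

lemma atom_in: "a \<in> atoms P \<Longrightarrow> a \<in> M" and atom_pos: "a \<in> atoms P \<Longrightarrow> 0 < a"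
  using nonneg by (fastforce simp: atoms_P)+

lemma prime_P:
  "prime P p \<longleftrightarrow> p \<noteq> 0 \<and> (\<forall>x\<in>M. \<forall>y\<in>M. x + y - p \<in> M \<longrightarrow> x - p \<in> M \<or> y - p \<in> M)"
  by (auto simp: prime_def divides_P)

lemma factorizations_P: "z \<in> factorizations P x \<longleftrightarrow> set z \<subseteq> atoms P \<and> sum_list z = x"
  by (simp add: factorizations_def)

lemma sum_list_in: "set z \<subseteq> M \<Longrightarrow> sum_list z \<in> M"
  by (induction z) (auto intro: zero_in add_in)

lemma multiple_in: "a \<in> M \<Longrightarrow> of_nat n * a \<in> M"
  by (induction n) (auto simp: algebra_simps intro: zero_in add_in)

lemma atom_dvd_atom: "a \<in> atoms P \<Longrightarrow> b \<in> atoms P \<Longrightarrow> b - a \<in> M \<Longrightarrow> a = b"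
proof -
  assume ab: "a \<in> atoms P" "b \<in> atoms P" "b - a \<in> M"
  have "b = a + (b - a)" by simp
  with ab show "a = b" by (metis atoms_P eq_iff_diff_eq_0)
qed

lemma prime_dvd_multiple:
  assumes "prime P p" "b \<in> M" "of_nat n * b - p \<in> M"
  shows "b - p \<in> M"
  using assms(3)
proof (induction n)
  case 0
  \<comment> \<open>Here the hypothesis says \<open>- p \<in> M\<close>, and adding \<open>b\<close> gives the claim.\<close>
  then show ?case using add_in[OF assms(2) 0] by simp
next
  case (Suc n)
  have "b + of_nat n * b - p \<in> M" using Suc.prems by (simp add: algebra_simps)
  then show ?case using assms(1,2) Suc.IH multiple_in[OF assms(2)] by (auto simp: prime_P)
qed

section \<open>At most one atom\<close>

text \<open>
  If \<open>m a = n b\<close> for atoms \<open>a\<close> and \<open>b\<close>, then \<open>m\<close> copies of \<open>a\<close> and \<open>n\<close> copies of \<open>b\<close> factor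
  the same element, and \<open>m = n\<close> forces \<open>a = b\<close>.
\<close>

lemma HF_monoid_iff_unique_atom:
  assumes "atomic P"
  shows "HF_monoid P \<longleftrightarrow> (\<forall>a\<in>atoms P. \<forall>b\<in>atoms P. a = b)"
proof (intro iffI ballI)
  fix a b assume HF: "HF_monoid P" and ab: "a \<in> atoms P" "b \<in> atoms P"
  obtain m n where mn: "m > 0" "n > 0" "of_nat m * a = of_nat n * b"
    using rat_commensurable atom_pos ab by metis
  have "of_nat m * a \<in> carrier P - Units P"
    using multiple_in[OF atom_in[OF ab(1)]] atom_pos[OF ab(1)] mn(1) by simp
  moreover have "replicate m a \<in> factorizations P (of_nat m * a)"
    using ab by (auto simp: factorizations_P sum_list_replicate)
  moreover have "replicate n b \<in> factorizations P (of_nat m * a)"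
    using ab mn(3) by (auto simp: factorizations_P sum_list_replicate)
  ultimately have "length (replicate m a) = length (replicate n b)"
    using HF unfolding HF_monoid_def by blast
  with mn show "a = b" by simp
next
  assume uniq: "\<forall>a\<in>atoms P. \<forall>b\<in>atoms P. a = b"
  have "length z = length z'"
    if z: "z \<in> factorizations P x" "z' \<in> factorizations P x" and x: "x \<noteq> 0" for x z z'
  proof -
    have "z \<noteq> []" using z x by (auto simp: factorizations_P)
    then have "hd z \<in> atoms P" using z by (auto simp: factorizations_P)
    then obtain a where a: "a \<in> atoms P" "atoms P = {a}" using uniq by blast
    then have "sum_list z = of_nat (length z) * a" "sum_list z' = of_nat (length z') * a"
      using z sum_list_two_values[of _ a a] by (auto simp: factorizations_P)
    then have "of_nat (length z) * a = of_nat (length z') * a"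
      using z by (metis factorizations_P)
    then show ?thesis using atom_pos[OF a(1)] by simp
  qed
  then show "HF_monoid P" using assms unfolding HF_monoid_def Units_P by blast
qed

text \<open>
  In a factorial monoid every atom is prime, being a product of primes that cannot be split.
\<close>

lemma factorial_atom_prime:
  assumes "factorial P" "a \<in> atoms P"
  shows "prime P a"
proof -
  have "a \<in> carrier P - Units P" using assms(2) by (simp add: atoms_P)
  then obtain ps where "set ps \<subseteq> {p \<in> carrier P. prime P p}" "list_product P ps = a"
    using assms(1) unfolding factorial_def by meson
  then have ps: "set ps \<subseteq> {p \<in> M. prime P p}" "sum_list ps = a" by simp_all
  then obtain p qs where pq: "ps = p # qs" using assms(2) by (cases ps) (auto simp: atoms_P)
  have p: "prime P p" "p \<in> M" and qs: "sum_list qs \<in> M"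
    using ps pq sum_list_in[of qs] by auto
  have "a = p + sum_list qs" using ps pq by simp
  moreover from this have "p = 0 \<or> sum_list qs = 0" using assms(2) p qs by (auto simp: atoms_P)
  ultimately show ?thesis using p by (auto simp: prime_P)
qed

lemma factorial_iff_unique_atom:
  assumes "atomic P"
  shows "factorial P \<longleftrightarrow> (\<forall>a\<in>atoms P. \<forall>b\<in>atoms P. a = b)"
proof (intro iffI ballI)
  fix a b assume fac: "factorial P" and ab: "a \<in> atoms P" "b \<in> atoms P"
  obtain m n where mn: "m > 0" "n > 0" "of_nat m * a = of_nat n * b"
    using rat_commensurable atom_pos ab by metis
  \<comment> \<open>The prime \<open>a\<close> divides \<open>m a = n b\<close>, hence \<open>b\<close>.\<close>
  have "of_nat n * b - a = of_nat (m - 1) * a"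
    using mn by (simp add: of_nat_diff algebra_simps)
  then have "of_nat n * b - a \<in> M" using multiple_in atom_in ab(1) by metis
  then have "b - a \<in> M"
    using prime_dvd_multiple factorial_atom_prime fac ab atom_in by blast
  with ab show "a = b" by (rule atom_dvd_atom)
next
  assume uniq: "\<forall>a\<in>atoms P. \<forall>b\<in>atoms P. a = b"
  have multiple: "\<exists>k. x = of_nat k * a" if a: "a \<in> atoms P" and x: "x \<in> M" for a x
  proof (cases "x = 0")
    case True
    then show ?thesis by (intro exI[of _ 0]) simp
  next
    case False
    then obtain z where "set z \<subseteq> atoms P" "sum_list z = x"
      using assms x by (auto simp: atomic_def factorizations_def)
    moreover from this have "set z \<subseteq> {a, a}" using uniq a by auto
    ultimately show ?thesis using sum_list_two_values[of z a a] by auto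
  qed
  have prime: "prime P a" if a: "a \<in> atoms P" for a
  proof -
    have "x - a \<in> M \<or> y - a \<in> M" if xy: "x \<in> M" "y \<in> M" "x + y - a \<in> M" for x y
    proof -
      obtain i j where ij: "x = of_nat i * a" "y = of_nat j * a"
        using multiple[OF a] xy by meson
      \<comment> \<open>If both multiplicities vanished, then \<open>- a\<close> would lie in \<open>M\<close>.\<close>
      have "i > 0 \<or> j > 0" using ij nonneg[OF xy(3)] atom_pos[OF a] by auto
      moreover have "of_nat k * a - a \<in> M" if "k > 0" for k
      proof -
        have "of_nat k * a - a = of_nat (k - 1) * a"
          using that by (simp add: of_nat_diff algebra_simps)
        then show ?thesis using multiple_in[OF atom_in[OF a]] by simp
      qed
      ultimately show ?thesis using ij by auto
    qed
    then show ?thesis using a by (simp add: prime_P atoms_P)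
  qed
  show "factorial P"
    unfolding factorial_def
  proof
    fix x assume "x \<in> carrier P - Units P"
    then obtain z where "set z \<subseteq> atoms P" "list_product P z = x"
      using assms by (auto simp: atomic_def factorizations_def)
    then show "\<exists>ps. set ps \<subseteq> {p \<in> carrier P. prime P p} \<and> list_product P ps = x"
      using prime atom_in by (intro exI[of _ z]) auto
  qed
qed

section \<open>At most two atoms\<close>

text \<open>
  The middle one of three atoms is a weighted mean, with positive rational weights, of the outer
  two; clearing denominators gives two factorizations of the same length.
\<close>

lemma OHF_monoid_no_three_atoms:
  assumes OHF: "OHF_monoid P"
    and abc: "a \<in> atoms P" "b \<in> atoms P" "c \<in> atoms P" "a < b" "b < c"
  shows False
proof -
  obtain i k where ik: "i > 0" "k > 0" "of_nat i * (b - a) = of_nat k * (c - b)"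
    using rat_commensurable[of "b - a" "c - b"] abc by auto
  define x where "x = of_nat (i + k) * b"
  let ?z = "replicate i a @ replicate k c" and ?z' = "replicate (i + k) b"
  have "x \<in> carrier P - Units P"
    using multiple_in[OF atom_in[OF abc(2)], of "i + k"] atom_pos[OF abc(2)] ik
    by (auto simp: x_def)
  moreover have "?z \<in> factorizations P x" "?z' \<in> factorizations P x"
    using abc ik(3) by (auto simp: factorizations_P sum_list_replicate x_def algebra_simps)
  moreover have "length ?z = length ?z'" by simp
  ultimately have "mset ?z = mset ?z'"
    using OHF unfolding OHF_monoid_def essentially_equal_P by blast
  then have "set ?z = set ?z'" by (rule mset_eq_setD)
  then show False using ik abc by auto
qed

lemma mset_two_values_determined:
  fixes a b :: rat
  assumes "set z \<subseteq> {a, b}" "set z' \<subseteq> {a, b}" "a \<noteq> b"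
    and "length z = length z'" "sum_list z = sum_list z'"
  shows "mset z = mset z'"
proof -
  have "count (mset z) b = count (mset z') b"
    using sum_list_two_values[OF assms(1)] sum_list_two_values[OF assms(2)] assms(3-) by simp
  then show ?thesis
    using mset_two_values[OF assms(1,3)] mset_two_values[OF assms(2,3)] assms(4) by simp
qed

lemma OHF_monoid_iff_atoms_le_2:
  assumes "atomic P"
  shows "OHF_monoid P \<longleftrightarrow> finite (atoms P) \<and> card (atoms P) \<le> 2"
proof
  assume OHF: "OHF_monoid P"
  show "finite (atoms P) \<and> card (atoms P) \<le> 2"
  proof (rule ccontr)
    assume "\<not> (finite (atoms P) \<and> card (atoms P) \<le> 2)"
    then have "infinite (atoms P) \<or> 3 \<le> card (atoms P)" by linarith
    then obtain T where T: "T \<subseteq> atoms P" "card T = 3"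
      using infinite_arbitrarily_large obtain_subset_with_card_n by metis
    obtain u v w where uvw: "T = {u, v, w}" "u \<noteq> v" "v \<noteq> w" "u \<noteq> w"
      using T(2) by (auto simp: card_3_iff)
    then have "u \<in> atoms P" "v \<in> atoms P" "w \<in> atoms P" using T(1) by auto
    moreover from uvw consider "u < v" "v < w" | "u < w" "w < v" | "v < u" "u < w"
      | "v < w" "w < u" | "w < u" "u < v" | "w < v" "v < u"
      by (meson linorder_neqE)
    ultimately show False using OHF_monoid_no_three_atoms[OF OHF] by cases blast+
  qed
next
  assume card: "finite (atoms P) \<and> card (atoms P) \<le> 2"
  \<comment> \<open>Allowing a superset of the set of atoms treats \<open>0\<close>, \<open>1\<close> and \<open>2\<close> atoms alike.\<close>
  obtain B where B: "finite B" "card B = 2 - card (atoms P)" "atoms P \<inter> B = {}"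
    using finite_arbitrarily_large_disj[OF infinite_UNIV_char_0] card by metis
  then have "card (atoms P \<union> B) = 2" using card by (simp add: card_Un_disjoint)
  then obtain a b where "atoms P \<union> B = {a, b}" and neq: "a \<noteq> b" by (auto simp: card_2_iff)
  then have ab: "atoms P \<subseteq> {a, b}" by blast
  have "mset z = mset z'"
    if "z \<in> factorizations P x" "z' \<in> factorizations P x" "length z = length z'" for x z z'
    using that ab neq by (intro mset_two_values_determined[of z a b z']) (auto simp: factorizations_P)
  then show "OHF_monoid P" using assms unfolding OHF_monoid_def essentially_equal_P by blast
qed

end

theorem proposition4p3:
  fixes M :: "rat set"
  assumes "puiseux_monoid M"
    and "M \<noteq> {0}"
    and "atomic (additive_monoid M)"
  shows "(HF_monoid (additive_monoid M) \<longleftrightarrow> factorial (additive_monoid M)) \<and>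
         (OHF_monoid (additive_monoid M) \<longleftrightarrow>
            finite (atoms (additive_monoid M)) \<and> card (atoms (additive_monoid M)) \<le> 2)"
  using HF_monoid_iff_unique_atom factorial_iff_unique_atom OHF_monoid_iff_atoms_le_2 assms(1,3)
  by blast

end
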